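(* Let $E$ be a real Banach space, $[a,b]_{\mathbb{T}}$ a time scale interval and $u:[a,b]_{\mathbb{T}}\to E$. Then $u$ is rd-continuous on $[a,b]_{\mathbb{T}}$ if and only if the following condition holds: for every $\varepsilon>0$ there exist $\delta_1,\dots,\delta_n>0$ and $\tau_1,\dots,\tau_n\in[a,b]_{\mathbb{T}}$ with $a=\tau_1<\dots<\tau_n=b$ and $[a,b]_{\mathbb{T}}\subseteq\bigcup_{i=1}^n\mathcal{O}^{\delta_i}_{\mathbb{T}}(\tau_i)$ such that for all $j=1,\dots,n$ and all $s,t\in\mathcal{O}^{\delta_j}_{\mathbb{T}}(\tau_j)$, $$\bigl(\tau_j\text{ is right-dense, or } s,t<\tau_j,\text{ or } s,t\ge\tau_j\bigr)\implies \|u(s)-u(t)\|_E<\varepsilon.$$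
   Context: A time scale $\mathbb{T}$ is a non-empty closed subset of $\mathbb{R}$ with the topology inherited from $\mathbb{R}$. For $a,b\in\mathbb{T}$, $[a,b]_{\mathbb{T}}:=[a,b]\cap\mathbb{T}$. The jump operators are $\sigma(t):=\inf\{s\in\mathbb{T}:s>t\}$ and $\rho(t):=\sup\{s\in\mathbb{T}:s<t\}$, with $\inf\emptyset:=\sup\mathbb{T}$, $\sup\emptyset:=\inf\mathbb{T}$. A point $t$ is right-dense if $\sigma(t)=t$, right-scattered if $\sigma(t)>t$, left-dense if $\rho(t)=t$, left-scattered if $\rho(t)<t$. Convention: when working on $[a,b]_{\mathbb{T}}$, it is treated as if it were the whole time scale $\mathbb{T}$; in particular $\sigma(b)=b$, so $b$ is right-dense. For $\delta>0$, $\mathcal{O}^{\delta}_{\mathbb{T}}(t):=(t-\delta,t+\delta)\cap\mathbb{T}$. A function $u$ is rd-continuous if it is continuous at all right-dense points and its left-sided limits exist (and are finite) at all left-dense points. *)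

theory Defs
  imports "HOL-Analysis.Analysis"
begin

definition time_scale :: "real set \<Rightarrow> bool" where
  "time_scale T \<longleftrightarrow> T \<noteq> {} \<and> closed T"

definition ts_interval :: "real set \<Rightarrow> real \<Rightarrow> real \<Rightarrow> real set" where
  "ts_interval T a b = {a..b} \<inter> T"

(* The case distinctions encode inf {} = sup T and sup {} = inf T. For t in T,
   the set T is bounded above (below) whenever Sup T (Inf T) is selected. *)

definition forward_jump :: "real set \<Rightarrow> real \<Rightarrow> real" where
  "forward_jump T t = (if {s \<in> T. s > t} = {} then Sup T else Inf {s \<in> T. s > t})"

definition backward_jump :: "real set \<Rightarrow> real \<Rightarrow> real" where
  "backward_jump T t = (if {s \<in> T. s < t} = {} then Inf T else Sup {s \<in> T. s < t})"

definition right_dense :: "real set \<Rightarrow> real \<Rightarrow> bool" where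
  "right_dense T t \<longleftrightarrow> forward_jump T t = t"

definition left_dense :: "real set \<Rightarrow> real \<Rightarrow> bool" where
  "left_dense T t \<longleftrightarrow> backward_jump T t = t"

definition ts_nbhd :: "real set \<Rightarrow> real \<Rightarrow> real \<Rightarrow> real set" where
  "ts_nbhd T \<delta> t = {t - \<delta><..<t + \<delta>} \<inter> T"

(* Only the values of u on T matter. A minimum of T is left-dense by convention;
   there the left-sided limit condition holds vacuously, as the filter is trivial. *)

definition rd_continuous :: "real set \<Rightarrow> (real \<Rightarrow> 'e::real_normed_vector) \<Rightarrow> bool" where
  "rd_continuous T u \<longleftrightarrow>
     (\<forall>t\<in>T. right_dense T t \<longrightarrow> continuous (at t within T) u) \<and>
     (\<forall>t\<in>T. left_dense T t \<longrightarrow> (\<exists>l. (u \<longlongrightarrow> l) (at t within T \<inter> {..<t})))"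

end

theory Submission imports Defs begin

text \<open>
  Right-dense continuity means that every point \<open>t\<close> has a neighbourhood on which \<open>u\<close> oscillates by
  less than \<open>\<epsilon>\<close>, provided that at a right-scattered \<open>t\<close> the points before \<open>t\<close> are not compared
  with those from \<open>t\<close> on: there the right part of a small neighbourhood is just \<open>{t}\<close>, and
  the left-sided limit controls the left part. Compactness extracts a finite subcover, whose
  centres, together with the endpoints, are enumerated increasingly.
  Conversely, near a right-dense \<open>t\<close>, or strictly to the left of any \<open>t\<close>, the points lie on the same
  side of a covering centre as soon as they are close to \<open>t\<close>; this gives continuity,
  respectively the Cauchy criterion for the left-sided limit.
\<close>

text \<open>The gap has length \<open>Inf A - t\<close> for the set \<open>A\<close> of later
  points. If \<open>A\<close> were empty, \<open>t\<close> would be the maximum of \<open>S\<close>,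
  and the convention for the empty infimum would make it right-dense.\<close>

lemma right_scattered_gap:
  fixes S :: "real set"
  assumes "t \<in> S" and "\<not> right_dense S t"
  obtains d where "d > 0" and "S \<inter> {t<..<t + d} = {}"
proof -
  define A where "A = {s \<in> S. s > t}"
  have "A \<noteq> {}"
  proof
    assume "A = {}"
    then have "Sup S = t"
      using assms(1) by (intro cSup_eq_maximum) (auto simp: A_def not_less)
    with \<open>A = {}\<close> assms(2) show False
      by (simp add: right_dense_def forward_jump_def A_def)
  qed
  have bdd: "bdd_below A"
    by (auto simp: A_def intro: bdd_belowI[of _ t])
  have "t \<le> Inf A"
    using \<open>A \<noteq> {}\<close> by (auto simp: A_def intro!: cInf_greatest)
  moreover have "Inf A \<noteq> t"
    using assms(2) \<open>A \<noteq> {}\<close> unfolding right_dense_def forward_jump_def A_def by presburger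
  ultimately have "Inf A - t > 0"
    by simp
  moreover have "S \<inter> {t<..<t + (Inf A - t)} = {}"
    using cInf_lower[OF _ bdd] by (force simp: A_def)
  ultimately show thesis
    by (rule that)
qed

text \<open>A nontrivial left filter means that points of \<open>S\<close> accumulate at
  \<open>t\<close> from below, so the supremum of the earlier points is \<open>t\<close>
  itself.\<close>

lemma left_dense_if_nontrivial_left:
  fixes S :: "real set"
  assumes "at t within S \<inter> {..<t} \<noteq> bot"
  shows "left_dense S t"
proof -
  have lim: "t islimpt (S \<inter> {..<t})"
    using assms by (simp add: trivial_limit_within)
  have near: "\<exists>s\<in>S. s < t \<and> t - e < s" if "e > 0" for e
    using lim that by (fastforce simp: islimpt_approachable dist_real_def)
  have ne: "{s \<in> S. s < t} \<noteq> {}"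
    using near[of 1] by auto
  moreover have "Sup {s \<in> S. s < t} = t"
  proof (rule cSup_eq_non_empty[OF ne])
    fix y assume y: "\<And>x. x \<in> {s \<in> S. s < t} \<Longrightarrow> x \<le> y"
    show "t \<le> y"
    proof (rule ccontr)
      assume "\<not> t \<le> y"
      with near[of "t - y"] y show False by force
    qed
  qed auto
  ultimately show ?thesis
    by (auto simp: left_dense_def backward_jump_def)
qed

lemma rd_continuous_left_limit:
  assumes "rd_continuous S u" and "t \<in> S"
  obtains l where "(u \<longlongrightarrow> l) (at t within S \<inter> {..<t})"
proof (cases "at t within S \<inter> {..<t} = bot")
  case True
  \<comment> \<open>The value \<open>0\<close> is arbitrary, since every value is a limit along the
    trivial filter.\<close>
  then show thesis using that[of 0] by simp
next
  case False
  then show thesis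
    using left_dense_if_nontrivial_left assms that unfolding rd_continuous_def by blast
qed

lemma rd_continuous_local_oscillation:
  fixes u :: "real \<Rightarrow> 'e::real_normed_vector"
  assumes rd: "rd_continuous S u" and t: "t \<in> S" and "\<epsilon> > 0"
  shows "\<exists>d>0. \<forall>x\<in>ts_nbhd S d t. \<forall>y\<in>ts_nbhd S d t.
    right_dense S t \<or> (x < t \<and> y < t) \<or> (x \<ge> t \<and> y \<ge> t) \<longrightarrow> norm (u x - u y) < \<epsilon>"
proof (cases "right_dense S t")
  case True
  then have "continuous (at t within S) u"
    using rd t by (simp add: rd_continuous_def)
  then obtain d where "d > 0" and d: "\<And>x. x \<in> S \<Longrightarrow> dist x t < d \<Longrightarrow> dist (u x) (u t) < \<epsilon> / 2"
    using \<open>\<epsilon> > 0\<close> by (auto simp: continuous_within_eps_delta dest!: spec[of _ "\<epsilon> / 2"])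
  have "norm (u x - u y) < \<epsilon>" if "x \<in> ts_nbhd S d t" "y \<in> ts_nbhd S d t" for x y
  proof -
    have "dist (u x) (u y) < \<epsilon>"
      by (rule dist_triangle_half_l[of _ "u t"]) (use that d in \<open>auto simp: ts_nbhd_def dist_real_def\<close>)
    then show ?thesis by (simp add: dist_norm)
  qed
  with \<open>d > 0\<close> show ?thesis by blast
next
  case False
  obtain l where "(u \<longlongrightarrow> l) (at t within S \<inter> {..<t})"
    using rd_continuous_left_limit[OF rd t] .
  then obtain d where "d > 0"
    and d: "\<And>x. x \<in> S \<Longrightarrow> x < t \<Longrightarrow> dist x t < d \<Longrightarrow> dist (u x) l < \<epsilon> / 2"
    \<comment> \<open>\<open>Lim_within\<close> also asks for \<open>0 < dist x t\<close>, which
      follows from \<open>x < t\<close>.\<close>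
    using \<open>\<epsilon> > 0\<close> unfolding Lim_within
    by (metis Int_iff dist_pos_lt half_gt_zero lessThan_iff order_less_irrefl)
  obtain e where "e > 0" and e: "S \<inter> {t<..<t + e} = {}"
    using right_scattered_gap[OF t False] .
  have "norm (u x - u y) < \<epsilon>"
    if xy: "x \<in> ts_nbhd S (min d e) t" "y \<in> ts_nbhd S (min d e) t"
      and side: "(x < t \<and> y < t) \<or> (x \<ge> t \<and> y \<ge> t)" for x y
  proof (cases "x < t")
    case True
    with side have "y < t" by linarith
    have "dist (u x) (u y) < \<epsilon>"
      by (rule dist_triangle_half_l[of _ l])
        (use xy True \<open>y < t\<close> d in \<open>auto simp: ts_nbhd_def dist_real_def\<close>)
    then show ?thesis by (simp add: dist_norm)
  next
    case False
    have "z = t" if "z \<in> ts_nbhd S (min d e) t" "z \<ge> t" for z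
      using that e by (force simp: ts_nbhd_def)
    then have "x = y" using False side xy by (metis not_less)
    then show ?thesis using \<open>\<epsilon> > 0\<close> by simp
  qed
  with \<open>d > 0\<close> \<open>e > 0\<close> False show ?thesis
    by (intro exI[of _ "min d e"]) auto
qed

lemma finite_set_strict_mono_enumeration:
  fixes F :: "'a::linorder set"
  assumes "finite F" and "a \<in> F" and "b \<in> F" and "F \<subseteq> {a..b}"
  obtains n \<tau> where "n \<ge> 1" and "\<tau> ` {1..n} = F" and "\<tau> 1 = a" and "\<tau> n = b"
    and "strict_mono_on {1..n::nat} \<tau>"
proof -
  define xs where "xs = sorted_list_of_set F"
  define n where "n = length xs"
  \<comment> \<open>List positions start at 0, the enumeration at 1.\<close>
  define \<tau> where "\<tau> = (\<lambda>i. xs ! (i - 1))"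
  have set: "set xs = F" and srt: "sorted_wrt (<) xs"
    using assms(1) by (auto simp: xs_def)
  have n: "n \<ge> 1"
    using set assms(2) by (cases xs) (auto simp: n_def)
  have mono: "strict_mono_on {1..n} \<tau>"
    by (rule strict_mono_onI) (auto simp: \<tau>_def n_def intro!: sorted_wrt_nth_less[OF srt])
  have img: "\<tau> ` {1..n} = F"
  proof -
    have "{1..n} = Suc ` {..<n}"
      by (simp add: image_Suc_lessThan)
    then have "\<tau> ` {1..n} = (!) xs ` {..<n}"
      by (simp add: image_image \<tau>_def)
    then show ?thesis
      using set by (auto simp: n_def set_conv_nth)
  qed
  have le: "\<tau> i \<le> \<tau> j" if "i \<in> {1..n}" "j \<in> {1..n}" "i \<le> j" for i j
    using strict_mono_onD[OF mono] that by (metis le_less)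
  obtain i where i: "i \<in> {1..n}" "\<tau> i = a" using img assms(2) by blast
  obtain j where j: "j \<in> {1..n}" "\<tau> j = b" using img assms(3) by blast
  have "\<tau> 1 \<in> {a..b}" "\<tau> n \<in> {a..b}" using img[symmetric] assms(4) n by (simp_all add: image_subset_iff)
  then have "\<tau> 1 = a" "\<tau> n = b"
    \<comment> \<open>By monotonicity \<open>\<tau> 1\<close> is at most \<open>a\<close> and
      \<open>\<tau> n\<close> at least \<open>b\<close>; the inclusion in \<open>{a..b}\<close>
      gives the reverse bounds.\<close>
    using le[of 1 i] le[of j n] i j n by auto
  with n img mono show thesis by (intro that)
qed

lemma ts_nbhd_finite_subcover:
  assumes "compact S" and "\<And>t. t \<in> S \<Longrightarrow> d t > 0"
  obtains F where "finite F" and "F \<subseteq> S" and "S \<subseteq> (\<Union>t\<in>F. ts_nbhd S (d t) t)"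
proof -
  have "S \<subseteq> (\<Union>t\<in>S. {t - d t<..<t + d t})"
    using assms(2) by force
  then obtain F where F: "F \<subseteq> S" "finite F" "S \<subseteq> (\<Union>t\<in>F. {t - d t<..<t + d t})"
    using compactE_image[OF assms(1), of S "\<lambda>t. {t - d t<..<t + d t}"] by auto
  \<comment> \<open>Compactness was applied to intervals open in the real line; intersecting them
    with \<open>S\<close> loses no point of \<open>S\<close>.\<close>
  then have "S \<subseteq> (\<Union>t\<in>F. ts_nbhd S (d t) t)"
    by (fastforce simp: ts_nbhd_def)
  with F that show thesis by blast
qed

text \<open>This is where completeness of the space enters: small oscillation to the left of
  \<open>t\<close> makes the image of the left filter Cauchy, hence convergent.\<close>

lemma left_limit_if_small_oscillation:
  fixes u :: "real \<Rightarrow> 'e::banach"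
  assumes osc: "\<And>\<epsilon>. \<epsilon> > 0 \<Longrightarrow> \<exists>d>0. \<forall>x\<in>ts_nbhd S d t. \<forall>y\<in>ts_nbhd S d t.
    x < t \<and> y < t \<longrightarrow> norm (u x - u y) < \<epsilon>"
  shows "\<exists>l. (u \<longlongrightarrow> l) (at t within S \<inter> {..<t})"
proof (cases "at t within S \<inter> {..<t} = bot")
  case True
  then show ?thesis by simp
next
  case False
  have "cauchy_filter (filtermap u (at t within S \<inter> {..<t}))"
    unfolding cauchy_filter_metric_filtermap
  proof (intro allI impI)
    fix \<epsilon> :: real assume "\<epsilon> > 0"
    from osc[OF this] obtain d where "d > 0" and d: "\<forall>x\<in>ts_nbhd S d t. \<forall>y\<in>ts_nbhd S d t.
        x < t \<and> y < t \<longrightarrow> norm (u x - u y) < \<epsilon>"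
      by blast
    have "eventually (\<lambda>x. x \<in> ts_nbhd S d t \<and> x < t) (at t within S \<inter> {..<t})"
      unfolding eventually_at using \<open>d > 0\<close>
      by (intro exI[of _ d]) (auto simp: ts_nbhd_def dist_real_def)
    then show "\<exists>P. eventually P (at t within S \<inter> {..<t}) \<and>
        (\<forall>x y. P x \<and> P y \<longrightarrow> dist (u x) (u y) < \<epsilon>)"
      unfolding dist_norm using d by (intro exI conjI) auto
  qed
  moreover have "filtermap u (at t within S \<inter> {..<t}) \<noteq> bot"
    using False by (simp add: filtermap_bot_iff)
  ultimately have "\<exists>l\<in>UNIV. filtermap u (at t within S \<inter> {..<t}) \<le> nhds l"
    using complete_UNIV unfolding complete_uniform by auto
  then show ?thesis
    by (auto simp: filterlim_def)
qed

text \<open>A neighbourhood of \<open>t\<close> inside that of a covering centre \<open>c\<close> lies on one side of \<open>c\<close>,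
  except when \<open>c = t\<close>.\<close>

lemma local_oscillation_if_near_centre:
  fixes u :: "real \<Rightarrow> 'e::real_normed_vector"
  assumes t: "t \<in> ts_nbhd S r c"
    and osc: "\<forall>x\<in>ts_nbhd S r c. \<forall>y\<in>ts_nbhd S r c.
      right_dense S c \<or> (x < c \<and> y < c) \<or> (x \<ge> c \<and> y \<ge> c) \<longrightarrow> norm (u x - u y) < \<epsilon>"
  shows "\<exists>d>0. \<forall>x\<in>ts_nbhd S d t. \<forall>y\<in>ts_nbhd S d t.
    right_dense S t \<or> (x < t \<and> y < t) \<longrightarrow> norm (u x - u y) < \<epsilon>"
proof -
  \<comment> \<open>\<open>e\<close> is the distance from \<open>t\<close> to the nearer end of the
    interval around \<open>c\<close>. The further bound \<open>\<bar>t - c\<bar>\<close> in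
    \<open>d\<close> keeps \<open>c\<close> out of the neighbourhood of \<open>t\<close>.\<close>
  define e where "e = min (t - (c - r)) (c + r - t)"
  define d where "d = (if t = c then e else min e \<bar>t - c\<bar>)"
  have "d > 0"
    using t by (auto simp: d_def e_def ts_nbhd_def)
  have "d \<le> e"
    by (auto simp: d_def)
  have "norm (u x - u y) < \<epsilon>"
    if "x \<in> ts_nbhd S d t" "y \<in> ts_nbhd S d t" "right_dense S t \<or> (x < t \<and> y < t)" for x y
  proof (rule osc[rule_format])
    show "x \<in> ts_nbhd S r c" "y \<in> ts_nbhd S r c"
      using that(1,2) \<open>d \<le> e\<close> by (auto simp: ts_nbhd_def e_def)
    \<comment> \<open>For \<open>t = c\<close> the assumed alternative carries over unchanged;
      otherwise \<open>x\<close> and \<open>y\<close> lie on the same side of \<open>c\<close> as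
      \<open>t\<close>.\<close>
    show "right_dense S c \<or> (x < c \<and> y < c) \<or> (x \<ge> c \<and> y \<ge> c)"
      using that by (cases "t = c"; cases "t < c") (auto simp: ts_nbhd_def d_def)
  qed
  with \<open>d > 0\<close> show ?thesis by blast
qed

lemma rd_continuous_if_local_oscillation:
  fixes u :: "real \<Rightarrow> 'e::banach"
  assumes osc: "\<And>t \<epsilon>. t \<in> S \<Longrightarrow> \<epsilon> > 0 \<Longrightarrow> \<exists>d>0. \<forall>x\<in>ts_nbhd S d t. \<forall>y\<in>ts_nbhd S d t.
    right_dense S t \<or> (x < t \<and> y < t) \<longrightarrow> norm (u x - u y) < \<epsilon>"
  shows "rd_continuous S u"
  unfolding rd_continuous_def
proof (intro conjI ballI impI)
  fix t assume t: "t \<in> S" and rd: "right_dense S t"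
  show "continuous (at t within S) u"
    unfolding continuous_within_eps_delta
  proof (intro allI impI)
    fix \<epsilon> :: real assume "\<epsilon> > 0"
    then obtain d where "d > 0"
      and d: "\<And>x y. x \<in> ts_nbhd S d t \<Longrightarrow> y \<in> ts_nbhd S d t \<Longrightarrow> norm (u x - u y) < \<epsilon>"
      using osc[OF t] rd by blast
    then show "\<exists>d>0. \<forall>x\<in>S. dist x t < d \<longrightarrow> dist (u x) (u t) < \<epsilon>"
      unfolding dist_norm using t
      \<comment> \<open>The oscillation bound is used with \<open>t\<close> itself as the second
        point.\<close>
      by (intro exI[of _ d] conjI ballI impI d) (auto simp: ts_nbhd_def)
  qed
next
  fix t assume "t \<in> S"
  then show "\<exists>l. (u \<longlongrightarrow> l) (at t within S \<inter> {..<t})"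
    by (intro left_limit_if_small_oscillation) (drule (1) osc, blast)
qed

theorem lemma1:
  fixes T :: "real set" and a b :: real and I :: "real set"
    and u :: "real \<Rightarrow> 'e::banach"
  assumes "time_scale T" and "a \<in> T" and "b \<in> T" and "a \<le> b"
    and "I = ts_interval T a b"
  shows "rd_continuous I u \<longleftrightarrow>
    (\<forall>\<epsilon>>0. \<exists>(n::nat) (\<delta>::nat \<Rightarrow> real) (\<tau>::nat \<Rightarrow> real).
       n \<ge> 1 \<and>
       (\<forall>i\<in>{1..n}. \<delta> i > 0 \<and> \<tau> i \<in> I) \<and>
       \<tau> 1 = a \<and> \<tau> n = b \<and> strict_mono_on {1..n} \<tau> \<and>
       I \<subseteq> (\<Union>i\<in>{1..n}. ts_nbhd I (\<delta> i) (\<tau> i)) \<and>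
       (\<forall>j\<in>{1..n}. \<forall>s\<in>ts_nbhd I (\<delta> j) (\<tau> j). \<forall>t\<in>ts_nbhd I (\<delta> j) (\<tau> j).
          right_dense I (\<tau> j) \<or> (s < \<tau> j \<and> t < \<tau> j) \<or> (s \<ge> \<tau> j \<and> t \<ge> \<tau> j)
          \<longrightarrow> norm (u s - u t) < \<epsilon>))"
  (is "_ \<longleftrightarrow> (\<forall>\<epsilon>>0. ?cover \<epsilon>)")
proof
  have I: "compact I" "a \<in> I" "b \<in> I" "I \<subseteq> {a..b}"
    using assms by (auto simp: ts_interval_def time_scale_def compact_Int_closed)
  assume rd: "rd_continuous I u"
  show "\<forall>\<epsilon>>0. ?cover \<epsilon>"
  proof (intro allI impI)
    fix \<epsilon> :: real assume "\<epsilon> > 0"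
    \<comment> \<open>Abbreviating the oscillation condition keeps the choice of a radius
      \<open>d t\<close> for every point a simple first-order step.\<close>
    define good where "good r t \<longleftrightarrow> (\<forall>x\<in>ts_nbhd I r t. \<forall>y\<in>ts_nbhd I r t.
      right_dense I t \<or> (x < t \<and> y < t) \<or> (x \<ge> t \<and> y \<ge> t) \<longrightarrow> norm (u x - u y) < \<epsilon>)" for r t
    have "\<forall>t\<in>I. \<exists>r. r > 0 \<and> good r t"
      unfolding good_def using rd_continuous_local_oscillation[OF rd _ \<open>\<epsilon> > 0\<close>] by (rule ballI)
    then obtain d where d: "\<And>t. t \<in> I \<Longrightarrow> d t > 0" and good: "\<And>t. t \<in> I \<Longrightarrow> good (d t) t"
      by metis
    obtain F where F: "finite F" "F \<subseteq> I" "I \<subseteq> (\<Union>t\<in>F. ts_nbhd I (d t) t)"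
      using ts_nbhd_finite_subcover[OF I(1) d] .
    \<comment> \<open>The subcover may miss the endpoints as centres. Both lie in \<open>I\<close>
      and have admissible radii, so they can be added.\<close>
    define G where "G = insert a (insert b F)"
    have G: "finite G" "a \<in> G" "b \<in> G" "G \<subseteq> I" "I \<subseteq> (\<Union>t\<in>G. ts_nbhd I (d t) t)"
      using F I by (auto simp: G_def)
    obtain n :: nat and \<tau> where \<tau>: "n \<ge> 1" "\<tau> ` {1..n} = G" "\<tau> 1 = a" "\<tau> n = b"
      "strict_mono_on {1..n} \<tau>"
      using finite_set_strict_mono_enumeration[OF G(1-3) subset_trans[OF G(4) I(4)]] .
    have mem: "\<tau> i \<in> I" if "i \<in> {1..n}" for i
      using imageI[OF that, of \<tau>] G(4) unfolding \<tau>(2) by (rule set_mp[rotated])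
    have sub: "I \<subseteq> (\<Union>i\<in>{1..n}. ts_nbhd I (d (\<tau> i)) (\<tau> i))"
      using G(5) unfolding \<tau>(2)[symmetric] by simp
    have pos: "\<forall>i\<in>{1..n}. d (\<tau> i) > 0 \<and> \<tau> i \<in> I"
      using mem d by simp
    have "\<forall>j\<in>{1..n}. good (d (\<tau> j)) (\<tau> j)"
      using mem good by simp
    then show "?cover \<epsilon>"
      unfolding good_def
      by (intro exI[of _ n] exI[of _ "\<lambda>i. d (\<tau> i)"] exI[of _ \<tau>] conjI \<tau> sub pos)
  qed
next
  assume cover: "\<forall>\<epsilon>>0. ?cover \<epsilon>"
  show "rd_continuous I u"
  proof (rule rd_continuous_if_local_oscillation)
    fix t \<epsilon> :: real assume "t \<in> I" "\<epsilon> > 0"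
    from cover[THEN spec, THEN mp, OF \<open>\<epsilon> > 0\<close>] obtain n :: nat and \<delta> \<tau> where
      sub: "I \<subseteq> (\<Union>i\<in>{1..n}. ts_nbhd I (\<delta> i) (\<tau> i))"
      and osc: "\<forall>j\<in>{1..n}. \<forall>x\<in>ts_nbhd I (\<delta> j) (\<tau> j). \<forall>y\<in>ts_nbhd I (\<delta> j) (\<tau> j).
        right_dense I (\<tau> j) \<or> (x < \<tau> j \<and> y < \<tau> j) \<or> (x \<ge> \<tau> j \<and> y \<ge> \<tau> j)
        \<longrightarrow> norm (u x - u y) < \<epsilon>"
      by (elim exE conjE)
    \<comment> \<open>The centre \<open>\<tau> j\<close> may differ from \<open>t\<close>, so its
      oscillation bound must still be transferred to a neighbourhood of \<open>t\<close>.\<close>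
    obtain j where j: "j \<in> {1..n}" "t \<in> ts_nbhd I (\<delta> j) (\<tau> j)"
      using sub \<open>t \<in> I\<close> by blast
    show "\<exists>d>0. \<forall>x\<in>ts_nbhd I d t. \<forall>y\<in>ts_nbhd I d t.
        right_dense I t \<or> (x < t \<and> y < t) \<longrightarrow> norm (u x - u y) < \<epsilon>"
      by (rule local_oscillation_if_near_centre[OF j(2) osc[THEN bspec, OF j(1)]])
  qed
qed

end
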